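(* A domain $\Omega\subset\mathbb D$ is a contractive domain if and only if there exists $R=R(\Omega)>0$ such that $\Omega$ contains no hyperbolic disc of hyperbolic radius $R$.
   Context: A domain $\Omega\subset\mathbb D$ is called contractive if every analytic map $f:\mathbb D\to\Omega$ satisfies $\sup_{z\in\mathbb D}\frac{(1-|z|^2)|f'(z)|}{1-|f(z)|^2}<1$. The hyperbolic distance is $d_h(z,w)=\frac12\log\frac{1+\rho^2}{1-\rho^2}$, $\rho=\big|\frac{z-w}{1-\overline wz}\big|$; a hyperbolic disc of radius $R$ is $\{w: d_h(w,a)<R\}$ for some $a\in\mathbb D$. *)

theory Defs
  imports "HOL-Complex_Analysis.Complex_Analysis"
begin

definition domain_in_disc :: "complex set \<Rightarrow> bool" where
  "domain_in_disc \<Omega> \<longleftrightarrow> open \<Omega> \<and> connected \<Omega> \<and> \<Omega> \<noteq> {} \<and> \<Omega> \<subseteq> ball 0 1"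

definition contractive :: "complex set \<Rightarrow> bool" where
  "contractive \<Omega> \<longleftrightarrow>
     (\<forall>f. f holomorphic_on ball 0 1 \<and> f ` ball 0 1 \<subseteq> \<Omega> \<longrightarrow>
        (\<exists>c<1. \<forall>z\<in>ball 0 1.
            (1 - (cmod z)^2) * cmod (deriv f z) / (1 - (cmod (f z))^2) \<le> c))"

definition pseudo_hyp_rho :: "complex \<Rightarrow> complex \<Rightarrow> real" where
  "pseudo_hyp_rho z w = cmod ((z - w) / (1 - cnj w * z))"

definition hyp_dist :: "complex \<Rightarrow> complex \<Rightarrow> real" where
  "hyp_dist z w = (1/2) * ln ((1 + (pseudo_hyp_rho z w)^2) / (1 - (pseudo_hyp_rho z w)^2))"

definition hyp_disc :: "complex \<Rightarrow> real \<Rightarrow> complex set" where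
  "hyp_disc a R = {w \<in> ball 0 1. hyp_dist w a < R}"

end

theory Submission
  imports Defs
begin

text \<open>
  If a self-map \<open>f\<close> of the disc omits \<open>w\<close>, then \<open>f\<close> followed by the Moebius map that sends \<open>w\<close> to \<open>0\<close>
  has a holomorphic square root, again a self-map of the disc. The Schwarz-Pick inequality for this
  root bounds the hyperbolic derivative of \<open>f\<close> at \<open>z\<close> by \<open>2 \<surd>t / (1 + t)\<close>, where \<open>t < 1\<close> is the
  pseudo-hyperbolic distance of \<open>f z\<close> and \<open>w\<close>. The bound increases with \<open>t\<close>, which gives contractivity
  when \<open>\<Omega>\<close> contains no large discs.

  Conversely, the universal covering map of \<open>\<Omega>\<close> has hyperbolic derivative close to \<open>1\<close> over the centre of
  a large disc, because the disc lifts. The covering is obtained as an extremal function: among the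
  self-maps \<open>F\<close> of the disc with \<open>F 0 = p\<close> through which discs in \<open>\<Omega>\<close> lift, take one that minimises
  \<open>\<bar>F' 0\<bar>\<close>. If \<open>F v \<notin> \<Omega>\<close> for some \<open>v\<close>, then precomposing with the twofold self-map of the disc branched
  over \<open>v\<close> preserves the lifting property and decreases \<open>\<bar>F' 0\<bar>\<close>; so \<open>F\<close> maps into \<open>\<Omega>\<close>.
\<close>

section \<open>The Schwarz-Pick inequality\<close>

lemma one_minus_cnj_mult_nonzero:
  assumes "cmod w < 1" "cmod z < 1"
  shows "1 - cnj w * z \<noteq> 0"
proof
  assume "1 - cnj w * z = 0"
  then have "cmod (cnj w * z) = 1" by simp
  moreover have "cmod (cnj w * z) < 1"
    using assms norm_mult_less[of "cnj w" 1 z 1] by simp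
  ultimately show False by simp
qed

lemma norm_sq_less_1: "cmod z < 1 \<Longrightarrow> (cmod z)\<^sup>2 < 1"
  by (simp add: abs_square_less_1)

lemma one_minus_norm_Moebius_sq:
  assumes "cmod w < 1" "cmod z < 1"
  shows "1 - (cmod (Moebius_function 0 w z))\<^sup>2 =
         (1 - (cmod w)\<^sup>2) * (1 - (cmod z)\<^sup>2) / (cmod (1 - cnj w * z))\<^sup>2"
proof -
  have "(cmod (1 - cnj w * z))\<^sup>2 - (cmod (z - w))\<^sup>2 = (1 - (cmod w)\<^sup>2) * (1 - (cmod z)\<^sup>2)"
    by (simp add: cmod_power2 algebra_simps) (simp add: power2_eq_square algebra_simps)
  then show ?thesis
    using one_minus_cnj_mult_nonzero[OF assms]
    by (simp add: Moebius_function_simple norm_divide power_divide field_simps)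
qed

lemma Moebius_function_field_differentiable:
  assumes "cmod w < 1" "cmod z < 1"
  shows "Moebius_function 0 w field_differentiable at z"
  using Moebius_function_holomorphic[OF assms(1)] assms(2)
  by (simp add: holomorphic_on_open field_differentiable_def)

text \<open>Moebius maps preserve the hyperbolic metric, so they attain equality in the Schwarz-Pick
  inequality. \<open>Moebius_function 0 w\<close> sends \<open>w\<close> to \<open>0\<close>; its
  inverse on the disc is \<open>Moebius_function 0 (- w)\<close>.\<close>

lemma norm_deriv_Moebius:
  assumes "cmod w < 1" "cmod z < 1"
  shows "cmod (deriv (Moebius_function 0 w) z) =
         (1 - (cmod (Moebius_function 0 w z))\<^sup>2) / (1 - (cmod z)\<^sup>2)"
proof -
  let ?d = "1 - cnj w * z"
  have nz: "?d \<noteq> 0" by (rule one_minus_cnj_mult_nonzero[OF assms])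
  have "((\<lambda>z. (z - w) / (1 - cnj w * z)) has_field_derivative (1 - cnj w * w) / ?d\<^sup>2) (at z)"
    using nz by (auto intro!: derivative_eq_intros simp: field_simps power2_eq_square)
  then have "deriv (Moebius_function 0 w) z = (1 - cnj w * w) / ?d\<^sup>2"
    by (intro DERIV_imp_deriv) (simp add: Moebius_function_simple[abs_def])
  moreover have "1 - cnj w * w = of_real (1 - (cmod w)\<^sup>2)"
    using complex_norm_square[of w] by (simp add: mult.commute)
  ultimately have "cmod (deriv (Moebius_function 0 w) z) = (1 - (cmod w)\<^sup>2) / (cmod ?d)\<^sup>2"
    using norm_sq_less_1[OF assms(1)]
    by (simp only: norm_divide norm_of_real norm_power abs_of_pos diff_gt_0_iff_gt)
  then show ?thesis
    using norm_sq_less_1[OF assms(2)] by (simp add: one_minus_norm_Moebius_sq[OF assms])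
qed

definition disc_self_map :: "(complex \<Rightarrow> complex) \<Rightarrow> bool" where
  "disc_self_map f \<longleftrightarrow> f holomorphic_on ball 0 1 \<and> f ` ball 0 1 \<subseteq> ball 0 1"

lemma disc_self_mapI:
  assumes "f holomorphic_on ball 0 1" "\<And>z. cmod z < 1 \<Longrightarrow> cmod (f z) < 1"
  shows "disc_self_map f"
  using assms by (auto simp: disc_self_map_def)

lemma disc_self_map_norm_less: "disc_self_map f \<Longrightarrow> cmod z < 1 \<Longrightarrow> cmod (f z) < 1"
  unfolding disc_self_map_def by force

lemma disc_self_map_field_differentiable:
  "disc_self_map f \<Longrightarrow> cmod z < 1 \<Longrightarrow> f field_differentiable at z"
  by (simp add: disc_self_map_def holomorphic_on_open field_differentiable_def)

lemma disc_self_map_compose: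
  assumes "disc_self_map f" "disc_self_map g"
  shows "disc_self_map (f \<circ> g)"
  using assms unfolding disc_self_map_def
  by (metis holomorphic_on_compose_gen image_comp image_mono subset_trans)

lemma disc_self_map_Moebius: "cmod w < 1 \<Longrightarrow> disc_self_map (Moebius_function 0 w)"
  by (simp add: disc_self_mapI Moebius_function_holomorphic Moebius_function_norm_lt_1)

lemma disc_self_map_square: "disc_self_map (\<lambda>z. z\<^sup>2)"
  by (auto intro!: disc_self_mapI holomorphic_intros simp: norm_power abs_square_less_1)

text \<open>Moving \<open>0\<close> to \<open>z\<close> before applying \<open>f\<close>, and
  \<open>f z\<close> to \<open>0\<close> after it, reduces the claim to the Schwarz lemma at the
  origin.\<close>

lemma Schwarz_Pick_deriv:
  assumes f: "disc_self_map f" and z: "cmod z < 1"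
  shows "(1 - (cmod z)\<^sup>2) * cmod (deriv f z) \<le> 1 - (cmod (f z))\<^sup>2"
proof -
  let ?A = "Moebius_function 0 (f z)" and ?B = "Moebius_function 0 (- z)"
  have fz: "cmod (f z) < 1" using disc_self_map_norm_less[OF f z] .
  have B0: "?B 0 = z" by (simp add: Moebius_function_of_zero)
  have self: "disc_self_map (?A \<circ> (f \<circ> ?B))"
    using f fz z by (intro disc_self_map_compose disc_self_map_Moebius) auto
  have "deriv (?A \<circ> (f \<circ> ?B)) 0 = deriv ?A (f z) * (deriv f z * deriv ?B 0)"
    using f fz z B0
    by (subst deriv_chain)
       (auto simp: deriv_chain field_differentiable_compose
             disc_self_map_field_differentiable Moebius_function_field_differentiable)
  moreover have "cmod (deriv (?A \<circ> (f \<circ> ?B)) 0) \<le> 1"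
    using self disc_self_map_norm_less[OF self] B0
    by (intro Schwarz_Lemma(2)[of _ 0]) (auto simp: disc_self_map_def Moebius_function_eq_zero)
  ultimately have "cmod (deriv ?A (f z)) * (cmod (deriv f z) * cmod (deriv ?B 0)) \<le> 1"
    by (simp add: norm_mult)
  moreover have "cmod (deriv ?A (f z)) = 1 / (1 - (cmod (f z))\<^sup>2)"
    using fz by (simp add: norm_deriv_Moebius Moebius_function_eq_zero)
  moreover have "cmod (deriv ?B 0) = 1 - (cmod z)\<^sup>2"
    using z B0 by (simp add: norm_deriv_Moebius)
  ultimately show ?thesis
    using norm_sq_less_1[OF fz] by (simp add: field_simps)
qed

section \<open>Self-maps that omit a value\<close>

lemma holomorphic_sqrt_on_disc:
  assumes "f holomorphic_on ball 0 1" "\<And>z. z \<in> ball 0 1 \<Longrightarrow> f z \<noteq> 0"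
  obtains g where "g holomorphic_on ball 0 1" "\<And>z. z \<in> ball (0::complex) 1 \<Longrightarrow> f z = (g z)\<^sup>2"
  using contractible_imp_holomorphic_sqrt[OF assms(1) convex_imp_contractible[OF convex_ball] assms(2)]
  by blast

text \<open>The Moebius map leaves the hyperbolic derivative of \<open>f\<close> unchanged, so that
  of \<open>h\<close> may be estimated. From \<open>h = s\<^sup>2\<close> the derivative gains the
  factor \<open>2 * sqrt t\<close>, Schwarz-Pick for \<open>s\<close> gives \<open>1 - t\<close>,
  and dividing by \<open>1 - t\<^sup>2\<close> leaves \<open>1 + t\<close> in the
  denominator.\<close>

lemma Schwarz_Pick_omitted_value:
  assumes f: "disc_self_map f" and w: "cmod w < 1" and omit: "\<And>z. cmod z < 1 \<Longrightarrow> f z \<noteq> w"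
    and z: "cmod z < 1"
  defines "t \<equiv> cmod (Moebius_function 0 w (f z))"
  shows "(1 - (cmod z)\<^sup>2) * cmod (deriv f z) / (1 - (cmod (f z))\<^sup>2) \<le> 2 * sqrt t / (1 + t)"
proof -
  define h where "h = Moebius_function 0 w \<circ> f"
  have h: "disc_self_map h"
    unfolding h_def using f w by (intro disc_self_map_compose disc_self_map_Moebius)
  have "h x \<noteq> 0" if "x \<in> ball 0 1" for x
    using omit[of x] that disc_self_map_norm_less[OF f, of x] one_minus_cnj_mult_nonzero[OF w, of "f x"]
    by (auto simp: h_def Moebius_function_simple)
  then obtain s where s: "s holomorphic_on ball 0 1" "\<And>x. x \<in> ball 0 1 \<Longrightarrow> h x = (s x)\<^sup>2"
    using holomorphic_sqrt_on_disc h unfolding disc_self_map_def by metis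
  have "cmod (s x) < 1" if "cmod x < 1" for x
    using disc_self_map_norm_less[OF h that] s(2)[of x] that
    by (simp add: norm_power abs_square_less_1)
  then have self: "disc_self_map s" using s(1) by (rule disc_self_mapI[rotated])
  have t1: "t < 1" using disc_self_map_norm_less[OF h z] by (simp add: t_def h_def)
  have t0: "t \<ge> 0" by (simp add: t_def)
  have st: "(cmod (s z))\<^sup>2 = t" using s(2)[of z] z by (simp add: t_def h_def norm_power)
  then have st': "cmod (s z) = sqrt t" by (metis norm_ge_zero real_sqrt_unique)
  have "deriv h z = deriv (\<lambda>x. (s x)\<^sup>2) z"
    using s(2) z
    by (intro deriv_cong_ev) (auto intro!: eventually_nhds_in_open[THEN eventually_mono, of "ball 0 1"])
  also have "\<dots> = 2 * s z * deriv s z"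
    using disc_self_map_field_differentiable[OF self z]
    by (intro DERIV_imp_deriv) (auto intro!: derivative_eq_intros simp: field_differentiable_derivI)
  finally have dh: "cmod (deriv h z) = 2 * sqrt t * cmod (deriv s z)"
    using st' by (simp add: norm_mult)
  have "deriv h z = deriv (Moebius_function 0 w) (f z) * deriv f z"
    unfolding h_def using w z disc_self_map_norm_less[OF f z] disc_self_map_field_differentiable[OF f z]
    by (simp add: deriv_chain Moebius_function_field_differentiable)
  then have dh': "cmod (deriv h z) = (1 - t\<^sup>2) / (1 - (cmod (f z))\<^sup>2) * cmod (deriv f z)"
    using norm_deriv_Moebius[OF w disc_self_map_norm_less[OF f z]] by (simp add: norm_mult t_def)
  have "(1 - (cmod z)\<^sup>2) * cmod (deriv s z) \<le> 1 - t"
    using Schwarz_Pick_deriv[OF self z] st by simp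
  then have "2 * sqrt t * ((1 - (cmod z)\<^sup>2) * cmod (deriv s z)) \<le> 2 * sqrt t * (1 - t)"
    using t0 by (intro mult_left_mono) auto
  then have "(1 - (cmod z)\<^sup>2) * cmod (deriv h z) \<le> 2 * sqrt t * (1 - t)"
    by (simp add: dh algebra_simps)
  then have "(1 - t) * ((1 + t) * ((1 - (cmod z)\<^sup>2) * cmod (deriv f z) / (1 - (cmod (f z))\<^sup>2)))
             \<le> (1 - t) * (2 * sqrt t)"
    unfolding dh' by (simp add: power2_eq_square algebra_simps)
  then have "(1 + t) * ((1 - (cmod z)\<^sup>2) * cmod (deriv f z) / (1 - (cmod (f z))\<^sup>2)) \<le> 2 * sqrt t"
    by (rule mult_left_le_imp_le) (use t1 in simp)
  then show ?thesis using t0 by (simp add: pos_le_divide_eq mult.commute)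
qed

section \<open>Lifting of discs\<close>

text \<open>
  Only maps \<open>h\<close> that stay a uniform distance \<open>e\<close> away from the complement of \<open>\<Omega>\<close> are lifted. A small
  translate of such an \<open>h\<close> is of the same kind, which is what makes the property pass to limits of \<open>F\<close>.
\<close>
definition disc_lifting :: "complex set \<Rightarrow> (complex \<Rightarrow> complex) \<Rightarrow> bool" where
  "disc_lifting \<Omega> F \<longleftrightarrow>
     (\<forall>u h e. cmod u < 1 \<and> h holomorphic_on ball 0 1 \<and> e > 0 \<and> (\<forall>z\<in>ball 0 1. ball (h z) e \<subseteq> \<Omega>) \<and>
        h 0 = F u \<longrightarrow>
        (\<exists>H. disc_self_map H \<and> H 0 = u \<and> (\<forall>z\<in>ball 0 1. F (H z) = h z)))"

lemma disc_liftingI: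
  assumes "\<And>u h e. \<lbrakk>cmod u < 1; h holomorphic_on ball 0 1; e > 0; \<And>z. cmod z < 1 \<Longrightarrow> ball (h z) e \<subseteq> \<Omega>;
             h 0 = F u\<rbrakk> \<Longrightarrow> \<exists>H. disc_self_map H \<and> H 0 = u \<and> (\<forall>z\<in>ball 0 1. F (H z) = h z)"
  shows "disc_lifting \<Omega> F"
  using assms unfolding disc_lifting_def by (metis mem_ball_0)

lemma disc_liftingE:
  assumes "disc_lifting \<Omega> F" "cmod u < 1" "h holomorphic_on ball 0 1" "e > 0"
    "\<And>z. cmod z < 1 \<Longrightarrow> ball (h z) e \<subseteq> \<Omega>" "h 0 = F u"
  obtains H where "disc_self_map H" "H 0 = u" "\<And>z. cmod z < 1 \<Longrightarrow> F (H z) = h z"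
  using assms unfolding disc_lifting_def by (metis mem_ball_0)

text \<open>An automorphism of the disc lifts every map by composition with its inverse. This one
  sends \<open>0\<close> to \<open>p\<close>, so the class in the extremal problem is
  nonempty.\<close>

lemma disc_lifting_Moebius:
  assumes p: "cmod p < 1" and "\<Omega> \<subseteq> ball 0 1"
  shows "disc_lifting \<Omega> (Moebius_function 0 (- p))"
proof (rule disc_liftingI)
  fix u h and e :: real
  assume u: "cmod u < 1" and h: "h holomorphic_on ball 0 1" and e: "e > 0"
    and sub: "\<And>z. cmod z < 1 \<Longrightarrow> ball (h z) e \<subseteq> \<Omega>" and h0: "h 0 = Moebius_function 0 (- p) u"
  have hz: "cmod (h z) < 1" if "cmod z < 1" for z
    using sub[OF that] e assms(2) by (metis centre_in_ball mem_ball_0 subsetD)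
  have "disc_self_map (Moebius_function 0 p \<circ> h)"
    using h hz p by (intro disc_self_map_compose disc_self_map_Moebius disc_self_mapI)
  moreover have "(Moebius_function 0 p \<circ> h) 0 = u"
    using p u h0 by (simp add: Moebius_function_compose)
  moreover have "Moebius_function 0 (- p) ((Moebius_function 0 p \<circ> h) z) = h z" if "z \<in> ball 0 1" for z
    using p hz that by (simp add: Moebius_function_compose)
  ultimately show "\<exists>H. disc_self_map H \<and> H 0 = u \<and> (\<forall>z\<in>ball 0 1. Moebius_function 0 (- p) (H z) = h z)"
    by blast
qed

text \<open>The critical value of this map is \<open>v\<close>; the parameter \<open>csqrt (- v)\<close> makes it fix \<open>0\<close>.\<close>
definition branched_square :: "complex \<Rightarrow> complex \<Rightarrow> complex" where
  "branched_square v =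
     Moebius_function 0 (- v) \<circ> ((\<lambda>z. z\<^sup>2) \<circ> Moebius_function 0 (- csqrt (- v)))"

lemma norm_csqrt_less_1: "cmod v < 1 \<Longrightarrow> cmod (csqrt v) < 1"
  by (metis abs_norm_cancel abs_square_less_1 norm_power power2_csqrt)

lemma disc_self_map_branched_square: "cmod v < 1 \<Longrightarrow> disc_self_map (branched_square v)"
  unfolding branched_square_def
  by (intro disc_self_map_compose disc_self_map_Moebius disc_self_map_square)
     (simp_all add: norm_csqrt_less_1)

lemma branched_square_0: "branched_square v 0 = 0"
  by (simp add: branched_square_def Moebius_function_of_zero Moebius_function_eq_zero)

text \<open>The strict inequality is what contradicts minimality later. The chain rule gives the
  exact value \<open>2 * sqrt \<bar>v\<bar> / (1 + \<bar>v\<bar>)\<close>.\<close>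

lemma norm_deriv_branched_square_0:
  assumes "cmod v < 1"
  shows "cmod (deriv (branched_square v) 0) < 1"
proof -
  let ?s = "csqrt (- v)"
  let ?A = "Moebius_function 0 (- v)" and ?B = "Moebius_function 0 (- ?s)"
  have s: "cmod ?s < 1" using norm_csqrt_less_1[of "- v"] assms by simp
  have s2: "(cmod ?s)\<^sup>2 = cmod v"
    by (metis norm_minus_cancel norm_power power2_csqrt)
  have B0: "?B 0 = ?s" by (simp add: Moebius_function_of_zero)
  have sq: "(\<lambda>z::complex. z\<^sup>2) field_differentiable at z" for z
    by (intro derivative_intros field_differentiable_power field_differentiable_ident)
  have dsq: "deriv (\<lambda>z::complex. z\<^sup>2) z = 2 * z" for z
    by (intro DERIV_imp_deriv) (auto intro!: derivative_eq_intros)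
  have "deriv (branched_square v) 0 = deriv ?A (- v) * (2 * ?s * deriv ?B 0)"
    unfolding branched_square_def using assms s B0 sq
    by (subst deriv_chain)
       (auto simp: deriv_chain dsq field_differentiable_compose Moebius_function_field_differentiable)
  moreover have "cmod (deriv ?A (- v)) = 1 / (1 - (cmod v)\<^sup>2)"
    using assms by (simp add: norm_deriv_Moebius Moebius_function_eq_zero)
  moreover have "cmod (deriv ?B 0) = 1 - cmod v"
    using s s2 B0 by (simp add: norm_deriv_Moebius)
  ultimately have "cmod (deriv (branched_square v) 0) = 2 * cmod ?s * (1 - cmod v) / (1 - (cmod v)\<^sup>2)"
    by (simp add: norm_mult)
  also have "\<dots> = 2 * cmod ?s / (1 + cmod v)"
  proof -
    have "1 - (cmod v)\<^sup>2 = (1 - cmod v) * (1 + cmod v)"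
      by (simp add: power2_eq_square algebra_simps)
    then show ?thesis using assms by simp
  qed
  also have "\<dots> < 1"
  proof -
    \<comment> \<open>Strict inequality of the arithmetic and geometric means of \<open>1\<close>
      and \<open>cmod v\<close>.\<close>
    have "0 < (1 - cmod ?s)\<^sup>2" using s by simp
    then have "2 * cmod ?s < 1 + cmod v" using s2 by (simp add: power2_diff)
    then show ?thesis by (simp add: divide_less_eq add_pos_nonneg)
  qed
  finally show ?thesis .
qed

text \<open>Since \<open>h\<close> stays in \<open>\<Omega>\<close> and \<open>F v\<close> does not,
  the lift \<open>H\<close> through \<open>F\<close> avoids the critical value \<open>v\<close>.
  Hence \<open>?M \<circ> H\<close> has a holomorphic square root, which lifts \<open>H\<close>
  further through the branched map.\<close>

lemma disc_lifting_branched_square: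
  assumes F: "disc_lifting \<Omega> F" and v: "cmod v < 1" and out: "F v \<notin> \<Omega>"
  shows "disc_lifting \<Omega> (F \<circ> branched_square v)"
proof (rule disc_liftingI)
  fix u h and e :: real
  let ?s = "csqrt (- v)"
  let ?M = "Moebius_function 0 v" and ?M' = "Moebius_function 0 (- v)"
  let ?N = "Moebius_function 0 ?s" and ?N' = "Moebius_function 0 (- ?s)"
  assume u: "cmod u < 1" and h: "h holomorphic_on ball 0 1" and e: "e > 0"
    and sub: "\<And>z. cmod z < 1 \<Longrightarrow> ball (h z) e \<subseteq> \<Omega>" and h0: "h 0 = (F \<circ> branched_square v) u"
  have s: "cmod ?s < 1" using norm_csqrt_less_1[of "- v"] v by simp
  have pu: "cmod (branched_square v u) < 1"
    using disc_self_map_norm_less[OF disc_self_map_branched_square[OF v] u] .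
  obtain H where H: "disc_self_map H" "H 0 = branched_square v u" "\<And>z. cmod z < 1 \<Longrightarrow> F (H z) = h z"
    using disc_liftingE[OF F pu h e sub] h0 by auto
  have MH: "disc_self_map (?M \<circ> H)"
    using H(1) v by (intro disc_self_map_compose disc_self_map_Moebius)
  have "H z \<noteq> v" if "cmod z < 1" for z
    using H(3)[OF that] sub[OF that] e out by force
  then have "(?M \<circ> H) z \<noteq> 0" if "z \<in> ball 0 1" for z
    using that one_minus_cnj_mult_nonzero[OF v disc_self_map_norm_less[OF H(1), of z]]
    by (simp add: Moebius_function_simple)
  then obtain g where g: "g holomorphic_on ball 0 1" "\<And>z. z \<in> ball 0 1 \<Longrightarrow> (?M \<circ> H) z = (g z)\<^sup>2"
    using holomorphic_sqrt_on_disc MH unfolding disc_self_map_def by metis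
  have N'u: "cmod (?N' u) < 1" using s u by (simp add: Moebius_function_norm_lt_1)
  have "(g 0)\<^sup>2 = (?N' u)\<^sup>2"
    using g(2)[of 0] H(2) v N'u
    by (simp add: branched_square_def Moebius_function_compose norm_power abs_square_less_1)
  \<comment> \<open>The sign of the root is free; it is chosen so that the new lift starts at
    \<open>u\<close>.\<close>
  then consider "g 0 = ?N' u" | "g 0 = - ?N' u" by (auto simp: power2_eq_iff)
  then obtain k where k: "k holomorphic_on ball 0 1" "k 0 = ?N' u"
    "\<And>z. cmod z < 1 \<Longrightarrow> ?M (H z) = (k z)\<^sup>2"
  proof cases
    case 1
    then show ?thesis using that[of g] g by auto
  next
    case 2
    then show ?thesis using that[of "\<lambda>z. - g z"] g by (auto intro: holomorphic_intros)
  qed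
  have kz: "cmod (k z) < 1" if "cmod z < 1" for z
    using k(3)[OF that] disc_self_map_norm_less[OF MH that] by (simp add: norm_power abs_square_less_1)
  have "disc_self_map (?N \<circ> k)"
    using k(1) kz s by (intro disc_self_map_compose disc_self_map_Moebius disc_self_mapI)
  moreover have "(?N \<circ> k) 0 = u"
    using k(2) s u by (simp add: Moebius_function_compose)
  moreover have "(F \<circ> branched_square v) ((?N \<circ> k) z) = h z" if "z \<in> ball 0 1" for z
  proof -
    have z: "cmod z < 1" using that by simp
    have "branched_square v ((?N \<circ> k) z) = ?M' ((k z)\<^sup>2)"
      using s kz[OF z] by (simp add: branched_square_def Moebius_function_compose)
    also have "\<dots> = H z"
      using v disc_self_map_norm_less[OF H(1) z] k(3)[OF z, symmetric]
      by (simp add: Moebius_function_compose)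
    finally show ?thesis using H(3)[OF z] by simp
  qed
  ultimately show "\<exists>H. disc_self_map H \<and> H 0 = u \<and> (\<forall>z\<in>ball 0 1. (F \<circ> branched_square v) (H z) = h z)"
    by blast
qed

text \<open>The chain rule for \<open>F \<circ> H = h\<close> and Schwarz-Pick for the lift
  \<open>H\<close> at \<open>0\<close>. In this way each liftable map bounds the derivative of
  \<open>F\<close> from below.\<close>

lemma disc_lifting_norm_deriv_le:
  assumes F: "disc_self_map F" "disc_lifting \<Omega> F" and u: "cmod u < 1"
    and h: "h holomorphic_on ball 0 1" "e > 0" "\<And>z. cmod z < 1 \<Longrightarrow> ball (h z) e \<subseteq> \<Omega>" "h 0 = F u"
  shows "cmod (deriv h 0) \<le> (1 - (cmod u)\<^sup>2) * cmod (deriv F u)"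
proof -
  obtain H where H: "disc_self_map H" "H 0 = u" "\<And>z. cmod z < 1 \<Longrightarrow> F (H z) = h z"
    using disc_liftingE[OF F(2) u h] by auto
  have "deriv h 0 = deriv (F \<circ> H) 0"
    using H(3) by (intro deriv_cong_ev)
      (auto intro!: eventually_nhds_in_open[THEN eventually_mono, of "ball 0 1"])
  also have "\<dots> = deriv F u * deriv H 0"
    using H F u by (subst deriv_chain) (auto simp: disc_self_map_field_differentiable)
  finally have "cmod (deriv h 0) = cmod (deriv H 0) * cmod (deriv F u)"
    by (simp add: norm_mult)
  moreover have "cmod (deriv H 0) \<le> 1 - (cmod u)\<^sup>2"
    using Schwarz_Pick_deriv[OF H(1), of 0] H(2) by simp
  ultimately show ?thesis by (simp add: mult_right_mono)
qed

section \<open>Limits of self-maps and of lifts\<close>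

lemma disc_self_map_limit:
  assumes g: "g holomorphic_on ball 0 1" and F: "\<And>n. disc_self_map (F n)"
    and lim: "\<And>z. cmod z < 1 \<Longrightarrow> (\<lambda>n. F n z) \<longlonglongrightarrow> g z"
    and u: "cmod u < 1" "cmod (g u) < 1"
  shows "disc_self_map g"
proof (cases "g constant_on ball 0 1")
  case True
  then show ?thesis using g u unfolding constant_on_def by (metis disc_self_mapI mem_ball_0)
next
  case False
  \<comment> \<open>Pointwise limits are a priori only bounded by \<open>1\<close>; an open image
    within the closed disc lies in its interior.\<close>
  then have op: "open (g ` ball 0 1)"
    using open_mapping_thm[OF g open_ball connected_ball open_ball subset_refl] by blast
  have "cmod (g z) \<le> 1" if "cmod z < 1" for z
  proof (rule tendsto_upperbound[OF tendsto_norm[OF lim[OF that]]])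
    show "\<forall>\<^sub>F n in sequentially. cmod (F n z) \<le> 1"
      using disc_self_map_norm_less[OF F that] by (simp add: less_imp_le)
  qed simp
  then have "g ` ball 0 1 \<subseteq> cball 0 1" by auto
  then have "g ` ball 0 1 \<subseteq> ball 0 1"
    using op interior_maximal interior_cball by metis
  then show ?thesis using g by (simp add: disc_self_map_def)
qed

lemma Montel_disc_self_maps:
  assumes F: "\<And>n::nat. disc_self_map (F n)"
  obtains g r where "g holomorphic_on ball 0 1" "strict_mono (r :: nat \<Rightarrow> nat)"
    "\<And>z. cmod z < 1 \<Longrightarrow> (\<lambda>n. F (r n) z) \<longlonglongrightarrow> g z"
    "\<And>K. \<lbrakk>compact K; K \<subseteq> ball 0 1\<rbrakk> \<Longrightarrow> uniform_limit K (F \<circ> r) g sequentially"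
proof (rule Montel[of "ball 0 1" "Collect disc_self_map" F])
  show "\<exists>B. \<forall>h\<in>Collect disc_self_map. \<forall>z\<in>K. cmod (h z) \<le> B" if "compact K" "K \<subseteq> ball 0 1" for K
    using that disc_self_map_norm_less by (intro exI[of _ 1]) (force simp: less_imp_le)
  show "range F \<subseteq> Collect disc_self_map" using F by auto
qed (use that in \<open>auto simp: disc_self_map_def\<close>)

text \<open>Uniform convergence near \<open>w\<close> controls \<open>F n (x n) - G (x n)\<close>,
  continuity of \<open>G\<close> the rest. It serves the limit of \<open>F n (H n z)\<close>, where
  both map and argument vary.\<close>

lemma uniform_limit_compose_tendsto:
  fixes F :: "nat \<Rightarrow> complex \<Rightarrow> complex"
  assumes "open S" "w \<in> S" "continuous_on S G" "x \<longlonglongrightarrow> w"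
    and ul: "\<And>K. \<lbrakk>compact K; K \<subseteq> S\<rbrakk> \<Longrightarrow> uniform_limit K F G sequentially"
  shows "(\<lambda>n. F n (x n)) \<longlonglongrightarrow> G w"
proof -
  obtain d where d: "d > 0" "cball w d \<subseteq> S"
    using assms(1,2) open_contains_cball by blast
  have ev: "\<forall>\<^sub>F n in sequentially. x n \<in> cball w d"
    using tendstoD[OF assms(4) d(1)] by eventually_elim (simp add: dist_commute)
  have "(\<lambda>n. G (x n)) \<longlonglongrightarrow> G w"
    using assms(1-4) by (metis continuous_on_eq_continuous_at isCont_tendsto_compose)
  moreover have "(\<lambda>n. F n (x n) - G (x n)) \<longlonglongrightarrow> 0"
  proof (rule tendstoI)
    fix \<epsilon> :: real assume "\<epsilon> > 0"
    then have "\<forall>\<^sub>F n in sequentially. \<forall>y\<in>cball w d. dist (F n y) (G y) < \<epsilon>"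
      using ul[of "cball w d"] d(2) by (auto dest: uniform_limitD)
    with ev show "\<forall>\<^sub>F n in sequentially. dist (F n (x n) - G (x n)) 0 < \<epsilon>"
      by eventually_elim (auto simp: dist_norm)
  qed
  ultimately show ?thesis using tendsto_add by fastforce
qed

text \<open>The map \<open>h\<close> starts at \<open>G u\<close>, not at \<open>F n u\<close>, so
  its translate by \<open>d n\<close> is lifted through \<open>F n\<close> instead. A subsequence of
  these lifts converges to a lift of \<open>h\<close> through \<open>G\<close>, because
  \<open>d n\<close> tends to \<open>0\<close>.\<close>

lemma disc_lifting_limit:
  assumes F: "\<And>n. disc_self_map (F n)" "\<And>n. disc_lifting \<Omega> (F n)" and G: "disc_self_map G"
    and ul: "\<And>K. \<lbrakk>compact K; K \<subseteq> ball 0 1\<rbrakk> \<Longrightarrow> uniform_limit K F G sequentially"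
  shows "disc_lifting \<Omega> G"
proof (rule disc_liftingI)
  fix u h and e :: real
  assume u: "cmod u < 1" and h: "h holomorphic_on ball 0 1" and e: "e > 0"
    and sub: "\<And>z. cmod z < 1 \<Longrightarrow> ball (h z) e \<subseteq> \<Omega>" and h0: "h 0 = G u"
  define d where "d n = F n u - G u" for n
  have "(\<lambda>n. F n u) \<longlonglongrightarrow> G u"
    using tendsto_uniform_limitI[OF ul[of "{u}"]] u by auto
  then have d0: "d \<longlonglongrightarrow> 0" unfolding d_def by (simp add: LIM_zero)
  \<comment> \<open>A translation by less than \<open>e / 2\<close> leaves a margin of
    \<open>e / 2\<close> to the complement of \<open>\<Omega>\<close>.\<close>
  then obtain N where N: "\<And>n. n \<ge> N \<Longrightarrow> cmod (d n) < e / 2"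
    using LIMSEQ_D[of d 0 "e / 2"] e by auto
  have "\<exists>H. disc_self_map H \<and> H 0 = u \<and> (\<forall>z. cmod z < 1 \<longrightarrow> F (n + N) (H z) = h z + d (n + N))" for n
  proof -
    have "ball (h z + d (n + N)) (e / 2) \<subseteq> \<Omega>" if "cmod z < 1" for z
    proof -
      have "ball (h z + d (n + N)) (e / 2) \<subseteq> ball (h z) e"
        using N[of "n + N"] by (intro ball_subset_ball_iff[THEN iffD2]) (simp add: dist_norm)
      then show ?thesis using sub[OF that] by blast
    qed
    moreover have "(\<lambda>z. h z + d (n + N)) holomorphic_on ball 0 1"
      using h by (intro holomorphic_intros)
    moreover have "h 0 + d (n + N) = F (n + N) u" using h0 by (simp add: d_def)
    ultimately obtain H where "disc_self_map H" "H 0 = u"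
      "\<And>z. cmod z < 1 \<Longrightarrow> F (n + N) (H z) = h z + d (n + N)"
      using disc_liftingE[OF F(2)[of "n + N"] u, of "\<lambda>z. h z + d (n + N)" "e / 2"] half_gt_zero[OF e]
      by metis
    then show ?thesis by blast
  qed
  then obtain H where H: "\<And>n. disc_self_map (H n)" "\<And>n. H n 0 = u"
    "\<And>n z. cmod z < 1 \<Longrightarrow> F (n + N) (H n z) = h z + d (n + N)"
    by metis
  obtain K r where K: "K holomorphic_on ball 0 1" "strict_mono (r :: nat \<Rightarrow> nat)"
    "\<And>z. cmod z < 1 \<Longrightarrow> (\<lambda>n. H (r n) z) \<longlonglongrightarrow> K z"
    by (rule Montel_disc_self_maps[of H, OF H(1)]) blast
  \<comment> \<open>The common value \<open>u\<close> of the lifts at \<open>0\<close> is inside the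
    disc, so the limit cannot be a constant of modulus \<open>1\<close>.\<close>
  have K0: "K 0 = u" using K(3)[of 0] H(2) by (simp add: LIMSEQ_const_iff)
  have Ks: "disc_self_map K"
    by (rule disc_self_map_limit[OF K(1) H(1) K(3), of 0]) (use K0 u in auto)
  have sub_lim: "filterlim (\<lambda>n. r n + N) sequentially sequentially"
    by (rule filterlim_compose[OF filterlim_add_const_nat_at_top filterlim_subseq[OF K(2)]])
  have "G (K z) = h z" if "z \<in> ball 0 1" for z
  proof (rule LIMSEQ_unique)
    have z: "cmod z < 1" using that by simp
    show "(\<lambda>n. F (r n + N) (H (r n) z)) \<longlonglongrightarrow> G (K z)"
    proof (rule uniform_limit_compose_tendsto[where S = "ball 0 1" and F = "\<lambda>n. F (r n + N)"
          and x = "\<lambda>n. H (r n) z" and G = G and w = "K z"])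
      show "continuous_on (ball 0 1) G"
        using G by (simp add: disc_self_map_def holomorphic_on_imp_continuous_on)
      show "uniform_limit L (\<lambda>n. F (r n + N)) G sequentially" if "compact L" "L \<subseteq> ball 0 1" for L
        using filterlim_compose[OF ul[OF that] sub_lim] .
    qed (use K(3)[OF z] disc_self_map_norm_less[OF Ks z] in auto)
    have "(\<lambda>n. h z + d (r n + N)) \<longlonglongrightarrow> h z + 0"
      by (intro tendsto_intros filterlim_compose[OF d0 sub_lim])
    then show "(\<lambda>n. F (r n + N) (H (r n) z)) \<longlonglongrightarrow> h z"
      using H(3)[OF z] by simp
  qed
  then show "\<exists>H. disc_self_map H \<and> H 0 = u \<and> (\<forall>z\<in>ball 0 1. G (H z) = h z)"
    using Ks K0 by blast
qed

section \<open>The extremal lifting map and its image\<close>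

lemma disc_lifting_norm_deriv_ge:
  assumes "disc_self_map F" "disc_lifting \<Omega> F" "d > 0" "ball (F 0) (2 * d) \<subseteq> \<Omega>"
  shows "d \<le> cmod (deriv F 0)"
proof -
  \<comment> \<open>This parametrises the disc of radius \<open>d\<close> about \<open>F 0\<close>;
    the other \<open>d\<close> in \<open>2 * d\<close> is the margin that lifting requires.\<close>
  let ?h = "\<lambda>z. F 0 + of_real d * z"
  have "ball (?h z) d \<subseteq> \<Omega>" if "cmod z < 1" for z
  proof -
    have "dist (?h z) (F 0) + d \<le> 2 * d" using that assms(3) by (simp add: dist_norm norm_mult)
    then have "ball (?h z) d \<subseteq> ball (F 0) (2 * d)" by (intro ball_subset_ball_iff[THEN iffD2]) simp
    then show ?thesis using assms(4) by blast
  qed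
  then have "cmod (deriv ?h 0) \<le> (1 - (cmod 0)\<^sup>2) * cmod (deriv F 0)"
    using assms(1-3) by (intro disc_lifting_norm_deriv_le[of F \<Omega> 0 ?h d]) (auto intro!: holomorphic_intros)
  moreover have "deriv ?h 0 = of_real d"
    by (intro DERIV_imp_deriv) (auto intro!: derivative_eq_intros)
  ultimately show ?thesis using assms(3) by simp
qed

text \<open>A minimising sequence has a limit by Montel's theorem, and the class is closed under
  such limits. The lower bound from a lifted disc about \<open>p\<close> keeps the minimum away from
  \<open>0\<close>.\<close>

lemma disc_lifting_extremal:
  assumes "open \<Omega>" "\<Omega> \<subseteq> ball 0 1" "p \<in> \<Omega>"
  obtains F where "disc_self_map F" "disc_lifting \<Omega> F" "F 0 = p" "deriv F 0 \<noteq> 0"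
    "\<And>G. \<lbrakk>disc_self_map G; disc_lifting \<Omega> G; G 0 = p\<rbrakk> \<Longrightarrow> cmod (deriv F 0) \<le> cmod (deriv G 0)"
proof -
  define C where "C = {F. disc_self_map F \<and> disc_lifting \<Omega> F \<and> F 0 = p}"
  define m where "m = (INF F\<in>C. cmod (deriv F 0))"
  have p: "cmod p < 1" using assms by auto
  have "Moebius_function 0 (- p) \<in> C"
    using p assms(2) disc_self_map_Moebius[of "- p"] disc_lifting_Moebius[OF p]
    by (simp add: C_def Moebius_function_of_zero)
  then have ne: "C \<noteq> {}" by blast
  have bdd: "bdd_below ((\<lambda>F. cmod (deriv F 0)) ` C)" by (rule bdd_belowI[of _ 0]) auto
  have "\<exists>F\<in>C. cmod (deriv F 0) < m + 1 / Suc n" for n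
    using cINF_less_iff[OF ne bdd, of "m + 1 / Suc n"] by (simp add: m_def)
  then have "\<forall>n. \<exists>F. F \<in> C \<and> cmod (deriv F 0) < m + 1 / Suc n" by blast
  from choice[OF this] obtain F where
    F: "\<And>n. F n \<in> C" "\<And>n. cmod (deriv (F n) 0) < m + 1 / Suc n" by blast
  have Fs: "disc_self_map (F n)" and Fl: "disc_lifting \<Omega> (F n)" and F0: "F n 0 = p" for n
    using F(1)[of n] by (auto simp: C_def)
  obtain G r where G: "G holomorphic_on ball 0 1" "strict_mono (r :: nat \<Rightarrow> nat)"
    "\<And>z. cmod z < 1 \<Longrightarrow> (\<lambda>n. F (r n) z) \<longlonglongrightarrow> G z"
    "\<And>K. \<lbrakk>compact K; K \<subseteq> ball 0 1\<rbrakk> \<Longrightarrow> uniform_limit K (F \<circ> r) G sequentially"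
    by (rule Montel_disc_self_maps[of F, OF Fs]) blast
  have G0: "G 0 = p" using G(3)[of 0] F0 by (simp add: LIMSEQ_const_iff)
  have Gs: "disc_self_map G"
    by (rule disc_self_map_limit[OF G(1) Fs G(3), of 0]) (use G0 p in auto)
  have Gl: "disc_lifting \<Omega> G"
    by (rule disc_lifting_limit[OF _ _ Gs G(4)]) (simp_all add: Fs Fl)
  \<comment> \<open>Locally uniform convergence carries over to the derivatives at \<open>0\<close>;
    any radius below \<open>1\<close> would do.\<close>
  have "uniform_limit (ball 0 (1/2)) (F \<circ> r) G sequentially"
    by (rule uniform_limit_on_subset[OF G(4)[of "cball 0 (1/2)"]]) auto
  moreover have "(F \<circ> r) n holomorphic_on ball 0 (1/2)" for n
    using Fs[of "r n"] holomorphic_on_subset[of "F (r n)" "ball 0 1" "ball 0 (1/2)"]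
    by (simp add: disc_self_map_def subset_ball)
  ultimately have "(\<lambda>n. deriv ((F \<circ> r) n) 0) \<longlonglongrightarrow> deriv G 0"
    by (intro deriv_complex_uniform_limit[where A = "ball 0 (1/2)"] always_eventually) (auto simp: o_def)
  then have lim: "(\<lambda>n. cmod (deriv (F (r n)) 0)) \<longlonglongrightarrow> cmod (deriv G 0)"
    by (auto intro: tendsto_norm)
  have lim': "(\<lambda>n. m + 1 / Suc (r n)) \<longlonglongrightarrow> m + 0"
    using filterlim_compose[OF LIMSEQ_inverse_real_of_nat filterlim_subseq[OF G(2)]]
    by (intro tendsto_intros) (simp add: inverse_eq_divide)
  have "cmod (deriv G 0) \<le> m"
    using LIMSEQ_le[OF lim lim'] F(2) by (auto simp: less_imp_le)
  then have min: "cmod (deriv G 0) \<le> cmod (deriv K 0)" if "K \<in> C" for K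
    using cINF_lower[OF bdd that] by (simp add: m_def)
  obtain d where d: "d > 0" "ball p d \<subseteq> \<Omega>" using assms openE by blast
  have "d / 2 \<le> cmod (deriv G 0)"
    by (rule disc_lifting_norm_deriv_ge[OF Gs Gl]) (use d G0 in auto)
  then have "deriv G 0 \<noteq> 0" using d(1) by auto
  then show ?thesis using that[OF Gs Gl G0] min by (auto simp: C_def)
qed

text \<open>If \<open>F v\<close> were outside \<open>\<Omega>\<close>, then
  \<open>F \<circ> branched_square v\<close> would compete with the extremal \<open>F\<close>: it
  lifts discs and has the same value at \<open>0\<close>. Its derivative there is strictly smaller,
  as \<open>deriv F 0\<close> is nonzero.\<close>

lemma disc_lifting_map_into_exists:
  assumes "open \<Omega>" "\<Omega> \<subseteq> ball 0 1" "\<Omega> \<noteq> {}"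
  obtains F where "disc_self_map F" "disc_lifting \<Omega> F" "F ` ball 0 1 \<subseteq> \<Omega>"
proof -
  obtain p where "p \<in> \<Omega>" using assms(3) by blast
  then obtain F where F: "disc_self_map F" "disc_lifting \<Omega> F" "F 0 = p" "deriv F 0 \<noteq> 0"
    "\<And>G. \<lbrakk>disc_self_map G; disc_lifting \<Omega> G; G 0 = p\<rbrakk> \<Longrightarrow> cmod (deriv F 0) \<le> cmod (deriv G 0)"
    using disc_lifting_extremal[OF assms(1,2)] by metis
  have "F v \<in> \<Omega>" if v: "cmod v < 1" for v
  proof (rule ccontr)
    assume "F v \<notin> \<Omega>"
    let ?b = "branched_square v"
    have b: "disc_self_map ?b" by (rule disc_self_map_branched_square[OF v])
    have "cmod (deriv F 0) \<le> cmod (deriv (F \<circ> ?b) 0)"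
      using F(1,3) b disc_lifting_branched_square[OF F(2) v \<open>F v \<notin> \<Omega>\<close>]
      by (intro F(5) disc_self_map_compose) (auto simp: branched_square_0)
    also have "deriv (F \<circ> ?b) 0 = deriv F 0 * deriv ?b 0"
      using F(1) b by (subst deriv_chain) (auto simp: disc_self_map_field_differentiable branched_square_0)
    finally show False
      using norm_deriv_branched_square_0[OF v] F(4) by (simp add: norm_mult)
  qed
  then have "F ` ball 0 1 \<subseteq> \<Omega>" by auto
  then show ?thesis by (rule that[OF F(1,2)])
qed

text \<open>A small ball that meets the image lies in a disc about an image point that lifts, hence
  lies in the image. So the image is open and closed in the connected set
  \<open>\<Omega>\<close>.\<close>

lemma disc_lifting_surjective:
  assumes "open \<Omega>" "connected \<Omega>" and F: "disc_lifting \<Omega> F" "F ` ball 0 1 \<subseteq> \<Omega>"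
  shows "F ` ball 0 1 = \<Omega>"
proof -
  let ?I = "F ` ball 0 1"
  have nbhd: "\<exists>e>0. ball q e \<subseteq> \<Omega> \<and> (?I \<inter> ball q e \<noteq> {} \<longrightarrow> ball q e \<subseteq> ?I)" if "q \<in> \<Omega>" for q
  proof -
    obtain d where d: "d > 0" "ball q d \<subseteq> \<Omega>" using \<open>open \<Omega>\<close> \<open>q \<in> \<Omega>\<close> openE by blast
    \<comment> \<open>The four parts are the distance from \<open>q\<close> to \<open>F u\<close>
      (one), the radius \<open>2 * e\<close> of the lifted disc, which then covers
      \<open>ball q e\<close> (two), and the margin \<open>e\<close> (one).\<close>
    define e where "e = d / 4"
    have e: "e > 0" "ball q (4 * e) \<subseteq> \<Omega>" using d by (auto simp: e_def)
    have "y \<in> ?I" if u: "cmod u < 1" "F u \<in> ball q e" and y: "y \<in> ball q e" for u y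
    proof -
      let ?h = "\<lambda>z. F u + of_real (2 * e) * z"
      have sub: "ball (?h z) e \<subseteq> \<Omega>" if "cmod z < 1" for z
      proof -
        have "dist (?h z) q \<le> dist (?h z) (F u) + dist (F u) q" by (rule dist_triangle)
        also have "dist (?h z) (F u) \<le> 2 * e"
          using that e(1) by (simp add: dist_norm norm_mult)
        finally have "dist (?h z) q + e \<le> 4 * e" using u(2) by (simp add: dist_commute)
        then have "ball (?h z) e \<subseteq> ball q (4 * e)" by (intro ball_subset_ball_iff[THEN iffD2]) simp
        then show ?thesis using e(2) by blast
      qed
      have hol: "?h holomorphic_on ball 0 1" by (intro holomorphic_intros)
      have h0: "?h 0 = F u" by simp
      obtain H where H: "disc_self_map H" "\<And>z. cmod z < 1 \<Longrightarrow> F (H z) = ?h z"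
        by (rule disc_liftingE[OF F(1) u(1) hol e(1) sub h0]) blast+
      define z where "z = (y - F u) / of_real (2 * e)"
      have "dist y (F u) < 2 * e"
        using u(2) y dist_triangle[of y "F u" q] by (simp add: dist_commute)
      then have z: "cmod z < 1" using e(1) by (simp add: z_def dist_norm norm_divide)
      have "F (H z) = y" using H(2)[OF z] e(1) by (simp add: z_def)
      then show "y \<in> ?I" using disc_self_map_norm_less[OF H(1) z] by force
    qed
    then have "?I \<inter> ball q e \<noteq> {} \<longrightarrow> ball q e \<subseteq> ?I" by auto
    moreover have "ball q e \<subseteq> \<Omega>"
      using e by (meson subset_ball order_trans mult_le_cancel_right1 one_le_numeral less_imp_le not_le)
    ultimately show ?thesis using e(1) by blast
  qed
  have "open ?I"
    unfolding open_contains_ball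
  proof
    fix q assume q: "q \<in> ?I"
    then obtain e where e: "e > 0" "?I \<inter> ball q e \<noteq> {} \<longrightarrow> ball q e \<subseteq> ?I"
      using nbhd[of q] F(2) by blast
    moreover have "q \<in> ?I \<inter> ball q e" using q e(1) by simp
    ultimately show "\<exists>e>0. ball q e \<subseteq> ?I" by blast
  qed
  moreover have "open (\<Omega> - ?I)"
    unfolding open_contains_ball
  proof
    fix q assume q: "q \<in> \<Omega> - ?I"
    then obtain e where e: "e > 0" "ball q e \<subseteq> \<Omega>" "?I \<inter> ball q e \<noteq> {} \<longrightarrow> ball q e \<subseteq> ?I"
      using nbhd[of q] by blast
    moreover have "q \<in> ball q e" using e(1) by simp
    ultimately show "\<exists>e>0. ball q e \<subseteq> \<Omega> - ?I" using q by blast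
  qed
  moreover have "?I \<noteq> {}" by simp
  ultimately show ?thesis
    using connectedD[OF \<open>connected \<Omega>\<close>, of ?I "\<Omega> - ?I"] F(2) by blast
qed

section \<open>Contractive domains\<close>

lemma tanh_artanh_real:
  fixes x :: real
  assumes "\<bar>x\<bar> < 1"
  shows "tanh (artanh x) = x"
proof -
  have "exp (- 2 * artanh x) = inverse (exp (ln ((1 + x) / (1 - x))))"
    unfolding exp_minus[symmetric] by (simp add: artanh_def)
  also have "\<dots> = (1 - x) / (1 + x)" using assms by (simp add: abs_less_iff)
  finally have "tanh (artanh x) = (1 - (1 - x) / (1 + x)) / (1 + (1 - x) / (1 + x))"
    by (simp only: tanh_real_altdef)
  then show ?thesis using assms by (simp add: divide_simps) (simp add: abs_less_iff)
qed

text \<open>With the square of the pseudo-hyperbolic distance inside the logarithm,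
  \<open>hyp_dist\<close> is \<open>artanh\<close> of that square; hence \<open>tanh R\<close> is
  compared with the square.\<close>

lemma hyp_dist_less_iff:
  assumes "cmod a < 1" "cmod w < 1"
  shows "hyp_dist w a < R \<longleftrightarrow> (cmod (Moebius_function 0 a w))\<^sup>2 < tanh R"
proof -
  define x where "x = (cmod (Moebius_function 0 a w))\<^sup>2"
  have x: "0 \<le> x" "x < 1"
    using Moebius_function_norm_lt_1[OF assms, of 0] by (auto simp: x_def abs_square_less_1)
  have "hyp_dist w a = artanh x"
    by (simp add: hyp_dist_def pseudo_hyp_rho_def Moebius_function_simple artanh_def x_def)
  moreover have "tanh (artanh x) < tanh R \<longleftrightarrow> artanh x < R" by simp
  ultimately show ?thesis using x tanh_artanh_real[of x] unfolding x_def[symmetric] by simp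
qed

lemma mono_two_sqrt_div:
  fixes t r :: real
  assumes "0 \<le> t" "t \<le> r" "r < 1"
  shows "2 * sqrt t / (1 + t) \<le> 2 * sqrt r / (1 + r)"
proof -
  have "sqrt t * sqrt r \<le> 1 * 1" using assms by (intro mult_mono) auto
  then have "0 \<le> (sqrt r - sqrt t) * (1 - sqrt t * sqrt r)"
    using assms by (intro mult_nonneg_nonneg) auto
  also have "\<dots> = sqrt r * (1 + (sqrt t)\<^sup>2) - sqrt t * (1 + (sqrt r)\<^sup>2)"
    by (simp add: algebra_simps power2_eq_square)
  finally have "sqrt t * (1 + r) \<le> sqrt r * (1 + t)" using assms by simp
  then show ?thesis using assms by (simp add: field_simps)
qed

text \<open>Contractivity gives a bound \<open>c < 1\<close> for the lifting map \<open>F\<close>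
  onto \<open>\<Omega>\<close>. A large disc about \<open>a\<close> in \<open>\<Omega>\<close> lifts
  to a point \<open>u\<close> over \<open>a\<close> and forces the hyperbolic derivative of
  \<open>F\<close> at \<open>u\<close> above \<open>c\<close>.\<close>

lemma contractive_imp_no_large_hyp_disc:
  assumes "domain_in_disc \<Omega>" and contr: "contractive \<Omega>"
  shows "\<exists>R>0. \<not> (\<exists>a\<in>ball 0 1. hyp_disc a R \<subseteq> \<Omega>)"
proof (rule ccontr)
  have \<Omega>: "open \<Omega>" "connected \<Omega>" "\<Omega> \<noteq> {}" "\<Omega> \<subseteq> ball 0 1"
    using assms(1) by (auto simp: domain_in_disc_def)
  assume "\<not> ?thesis"
  then have discs: "\<exists>a\<in>ball 0 1. hyp_disc a R \<subseteq> \<Omega>" if "R > 0" for R using that by blast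
  obtain F where F: "disc_self_map F" "disc_lifting \<Omega> F" "F ` ball 0 1 \<subseteq> \<Omega>"
    using disc_lifting_map_into_exists \<Omega> by metis
  have onto: "F ` ball 0 1 = \<Omega>" using disc_lifting_surjective \<Omega> F by blast
  obtain c where c: "c < 1" "\<And>z. cmod z < 1 \<Longrightarrow>
      (1 - (cmod z)\<^sup>2) * cmod (deriv F z) / (1 - (cmod (F z))\<^sup>2) \<le> c"
    using contr F unfolding contractive_def disc_self_map_def by (metis mem_ball_0)
  obtain \<rho> where \<rho>: "max c 0 < \<rho>" "\<rho> < 1" using c(1) dense[of "max c 0" 1] by auto
  have \<rho>1: "\<rho>\<^sup>2 < 1" "0 < \<rho>" using \<rho> by (auto simp: abs_square_less_1)
  \<comment> \<open>Any value strictly between \<open>\<rho>\<^sup>2\<close> and \<open>1\<close>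
    would serve as \<open>tanh R\<close>; it makes the hyperbolic disc contain the closed
    pseudo-hyperbolic disc of radius \<open>\<rho>\<close> about \<open>a\<close>.\<close>
  define R where "R = artanh ((1 + \<rho>\<^sup>2) / 2)"
  have R: "tanh R = (1 + \<rho>\<^sup>2) / 2"
    unfolding R_def using \<rho>1 zero_le_power2[of \<rho>] by (intro tanh_artanh_real) simp
  have "tanh R > 0" unfolding R by (simp add: add_pos_nonneg)
  then have "R > 0" by simp
  obtain a where a: "cmod a < 1" "hyp_disc a R \<subseteq> \<Omega>"
    using discs[OF \<open>R > 0\<close>] by auto
  \<comment> \<open>A parametrisation of the pseudo-hyperbolic disc of radius \<open>\<rho>\<close>
    about \<open>a\<close>, with hyperbolic derivative \<open>\<rho>\<close> at
    \<open>0\<close>.\<close>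
  define h where "h = (\<lambda>z. Moebius_function 0 (- a) (of_real \<rho> * z))"
  have scale: "cmod (of_real \<rho> * z) < 1" "(cmod (of_real \<rho> * z))\<^sup>2 < tanh R" if "cmod z \<le> 1" for z
  proof -
    have le: "cmod (of_real \<rho> * z) \<le> \<rho>"
      using that \<rho>1 by (simp add: norm_mult mult_left_le)
    then show "cmod (of_real \<rho> * z) < 1" using \<rho> by simp
    have "(cmod (of_real \<rho> * z))\<^sup>2 \<le> \<rho>\<^sup>2" using le by (intro power_mono) auto
    also have "\<rho>\<^sup>2 < tanh R" using R \<rho>1 by simp
    finally show "(cmod (of_real \<rho> * z))\<^sup>2 < tanh R" .
  qed
  have holM: "Moebius_function 0 (- a) holomorphic_on ball 0 1"
    using a by (intro Moebius_function_holomorphic) simp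
  \<comment> \<open>On the closed disc the image is compact, which yields the uniform margin
    \<open>e\<close> demanded by \<open>disc_lifting\<close>.\<close>
  have "continuous_on (cball 0 1) h"
    unfolding h_def using scale(1)
    by (intro continuous_on_compose2[OF holomorphic_on_imp_continuous_on[OF holM]] continuous_intros) auto
  then have "compact (h ` cball 0 1)" by (intro compact_continuous_image) auto
  moreover have sub: "h ` cball 0 1 \<subseteq> \<Omega>"
  proof
    fix y assume "y \<in> h ` cball 0 1"
    then obtain z where z: "cmod z \<le> 1" "y = h z" by auto
    have "cmod y < 1"
      using z a scale(1) by (simp add: h_def Moebius_function_norm_lt_1)
    moreover have "Moebius_function 0 a y = of_real \<rho> * z"
      using z a scale(1) by (simp add: h_def Moebius_function_compose)
    ultimately show "y \<in> \<Omega>"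
      using a scale(2)[OF z(1)] hyp_dist_less_iff[OF a(1), of y R] by (auto simp: hyp_disc_def)
  qed
  ultimately obtain e where e: "e > 0" "(\<Union>x\<in>h ` cball 0 1. ball x e) \<subseteq> \<Omega>"
    using compact_subset_open_imp_ball_epsilon_subset \<Omega>(1) by metis
  have h0: "h 0 = a" by (simp add: h_def Moebius_function_of_zero)
  then have "a \<in> \<Omega>" using sub by force
  \<comment> \<open>Surjectivity provides a point over the centre \<open>a\<close> at which the lift
    can start.\<close>
  then obtain u where u: "cmod u < 1" "F u = a" using onto by force
  have holh: "h holomorphic_on ball 0 1"
    unfolding h_def using scale(1)
    by (intro holomorphic_on_compose_gen[OF _ holM, of "\<lambda>z. of_real \<rho> * z", unfolded o_def]
        holomorphic_intros) auto
  have "ball (h z) e \<subseteq> \<Omega>" if "cmod z < 1" for z using e(2) that by force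
  then have le: "cmod (deriv h 0) \<le> (1 - (cmod u)\<^sup>2) * cmod (deriv F u)"
    using disc_lifting_norm_deriv_le[OF F(1,2) u(1) holh e(1)] h0 u(2) by simp
  have "deriv (Moebius_function 0 (- a) \<circ> (\<lambda>z. of_real \<rho> * z)) 0 =
        deriv (Moebius_function 0 (- a)) (of_real \<rho> * 0) * deriv (\<lambda>z. of_real \<rho> * z) 0"
    using a by (intro deriv_chain) (auto intro!: derivative_intros Moebius_function_field_differentiable)
  moreover have "deriv (\<lambda>z. of_real \<rho> * z) (0::complex) = of_real \<rho>" by simp
  ultimately have "cmod (deriv h 0) = (1 - (cmod a)\<^sup>2) * \<rho>"
    using a \<rho>1 norm_deriv_Moebius[of "- a" 0]
    by (simp add: h_def o_def norm_mult Moebius_function_of_zero)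
  then have "\<rho> \<le> (1 - (cmod u)\<^sup>2) * cmod (deriv F u) / (1 - (cmod (F u))\<^sup>2)"
    using le u(2) norm_sq_less_1[OF a(1)] by (simp add: pos_le_divide_eq mult.commute)
  also have "\<dots> \<le> c" using c(2) u(1) by blast
  finally show False using \<rho> by simp
qed

text \<open>Around each value \<open>f z\<close> the disc of radius \<open>R\<close> contains a
  point \<open>w\<close> outside \<open>\<Omega>\<close>, which \<open>f\<close> omits. The
  omitted-value bound is then uniform in \<open>z\<close>, since \<open>t < r\<close> with
  \<open>r\<close> depending on \<open>R\<close> only.\<close>

lemma no_large_hyp_disc_imp_contractive:
  assumes "domain_in_disc \<Omega>" and R: "R > 0" "\<And>a. cmod a < 1 \<Longrightarrow> \<not> hyp_disc a R \<subseteq> \<Omega>"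
  shows "contractive \<Omega>"
proof -
  have \<Omega>: "\<Omega> \<subseteq> ball 0 1" using assms(1) by (simp add: domain_in_disc_def)
  define r where "r = sqrt (tanh R)"
  have r: "0 < r" "r < 1" "r\<^sup>2 = tanh R" using R(1) tanh_real_lt_1[of R] by (auto simp: r_def)
  have "sqrt r < 1" using r by simp
  then have "0 < (1 - sqrt r)\<^sup>2" by simp
  then have c: "2 * sqrt r / (1 + r) < 1" using r by (simp add: power2_diff divide_less_eq)
  show "contractive \<Omega>"
    unfolding contractive_def
  proof (intro allI impI, elim conjE)
    fix f assume f: "f holomorphic_on ball 0 1" "f ` ball 0 1 \<subseteq> \<Omega>"
    then have fs: "disc_self_map f" using \<Omega> by (auto simp: disc_self_map_def)
    have "(1 - (cmod z)\<^sup>2) * cmod (deriv f z) / (1 - (cmod (f z))\<^sup>2) \<le> 2 * sqrt r / (1 + r)"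
      if z: "cmod z < 1" for z
    proof -
      have fz: "cmod (f z) < 1" by (rule disc_self_map_norm_less[OF fs z])
      obtain w where w: "cmod w < 1" "hyp_dist w (f z) < R" "w \<notin> \<Omega>"
        using R(2)[OF fz] by (auto simp: hyp_disc_def)
      define t where "t = cmod (Moebius_function 0 w (f z))"
      \<comment> \<open>Symmetry of the pseudo-hyperbolic distance: \<open>t\<close> is centred at
        the omitted \<open>w\<close>, the disc at \<open>f z\<close>.\<close>
      have "cmod (1 - cnj w * f z) = cmod (1 - cnj (f z) * w)"
        using complex_mod_cnj[of "1 - cnj w * f z"] by (simp add: mult.commute)
      then have "t = cmod (Moebius_function 0 (f z) w)"
        by (simp add: t_def Moebius_function_simple norm_divide norm_minus_commute)
      then have "t\<^sup>2 < r\<^sup>2" using w fz r hyp_dist_less_iff[of "f z" w R] by simp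
      then have "t < r" using r by (simp add: power2_less_imp_less)
      have "(1 - (cmod z)\<^sup>2) * cmod (deriv f z) / (1 - (cmod (f z))\<^sup>2) \<le> 2 * sqrt t / (1 + t)"
        unfolding t_def using w f by (intro Schwarz_Pick_omitted_value[OF fs w(1) _ z]) force
      also have "\<dots> \<le> 2 * sqrt r / (1 + r)"
        using \<open>t < r\<close> r by (intro mono_two_sqrt_div) (auto simp: t_def)
      finally show ?thesis .
    qed
    with c show "\<exists>c<1. \<forall>z\<in>ball 0 1.
        (1 - (cmod z)\<^sup>2) * cmod (deriv f z) / (1 - (cmod (f z))\<^sup>2) \<le> c"
      by auto
  qed
qed

theorem mainTheorem13:
  assumes "domain_in_disc \<Omega>"
  shows "contractive \<Omega> \<longleftrightarrow>
         (\<exists>R>0. \<not> (\<exists>a\<in>ball 0 1. hyp_disc a R \<subseteq> \<Omega>))"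
  using contractive_imp_no_large_hyp_disc[OF assms] no_large_hyp_disc_imp_contractive[OF assms]
  by (metis mem_ball_0)

end
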